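(* For each positive integer $n$ let $Q_n(\theta)=\prod_{k=1}^n(1+e^{ik\theta})$, $\theta\in\mathbb{R}/2\pi\mathbb{Z}$. Then for each $1\le p<\infty$, as $n\to\infty$, $$\|Q_n\|_p\sim\Big(\frac{6}{p\pi}\Big)^{\frac{1}{2p}}\,2^n\,n^{-\frac{3}{2p}}.$$
   Context: For $f:\mathbb{R}/2\pi\mathbb{Z}\to\mathbb{C}$ and $1\le p<\infty$, $\|f\|_p=\Big(\frac{1}{2\pi}\int_0^{2\pi}|f(\theta)|^p\,d\theta\Big)^{1/p}$ (normalized measure). The notation $a_n\sim b_n$ means $a_n/b_n\to1$ as $n\to\infty$; $p$ is fixed. *)

theory Defs
  imports "HOL-Analysis.Analysis" "HOL-Library.Landau_Symbols"
begin

(* Functions on the circle are represented by 2*pi-periodic functions on the reals.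
   The circle carries its normalized Lebesgue measure, so constants c have norm |c|. *)
definition circle_Lp_norm :: "real \<Rightarrow> (real \<Rightarrow> complex) \<Rightarrow> real" where
  "circle_Lp_norm p f =
     (1 / (2 * pi) * (LBINT \<theta>:{0..2 * pi}. cmod (f \<theta>) powr p)) powr (1 / p)"

definition Q :: "nat \<Rightarrow> real \<Rightarrow> complex" where
  "Q n \<theta> = (\<Prod>k = 1..n. 1 + exp (\<i> * of_nat k * of_real \<theta>))"

end

theory Submission
  imports Defs "HOL-Probability.Distributions" "HOL-Real_Asymp.Real_Asymp"
begin

text \<open>
  Since \<open>|1 + e\<^sup>i\<^sup>t| = 2 |cos (t / 2)|\<close>, the modulus of \<open>Q\<^sub>n\<close> is \<open>2\<^sup>n\<close> times the product
  \<open>D\<^sub>n(\<theta>)\<close> of the \<open>|cos (k\<theta> / 2)|\<close>, \<open>k \<le> n\<close>, and the theorem is Laplace's method for the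
  integral of \<open>D\<^sub>n\<^sup>p\<close>: all the mass sits in a peak at \<open>\<theta> = 0\<close> of width of order \<open>n\<^sup>-\<^sup>3\<^sup>/\<^sup>2\<close>.
  By the symmetry \<open>\<theta> \<mapsto> 2\<pi> - \<theta>\<close> it is enough to integrate over \<open>[0, \<pi>]\<close>, which is cut at
  \<open>\<pi> / n\<close>.

  On \<open>[0, \<pi>/n]\<close> every argument \<open>k\<theta> / 2\<close> lies in \<open>[0, \<pi>/2]\<close>, where \<open>cos y \<le> exp (-y\<^sup>2 / 2)\<close>. As
  the sum of \<open>k\<^sup>2\<close> over \<open>k \<le> n\<close> is at least \<open>n\<^sup>3 / 3\<close>, this gives
  \<open>D\<^sub>n(\<theta>)\<^sup>p \<le> exp (- p n\<^sup>3 \<theta>\<^sup>2 / 24)\<close>. In the variable \<open>x\<close> with \<open>x\<^sup>2 = p n\<^sup>3 \<theta>\<^sup>2 / 24\<close> the bound is the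
  function \<open>exp (-x\<^sup>2)\<close>, independent of \<open>n\<close>. It is also the pointwise limit, because
  the quartic error terms add up to \<open>O(n\<^sup>5 \<theta>\<^sup>4) = O(1/n)\<close> for fixed \<open>x\<close> (\<open>cos_product_rescaled_limit\<close>).
  Dominated convergence evaluates this part (\<open>cos_product_peak_integral\<close>).

  On \<open>[\<pi>/n, \<pi>]\<close> the rough bound \<open>|cos y| \<le> exp (- sin\<^sup>2 y / 2)\<close> is enough: the sum of
  \<open>sin\<^sup>2 (k\<theta> / 2) = (1 - cos (k\<theta>)) / 2\<close> is controlled by the Dirichlet kernel and is at least
  \<open>n / 4\<close>, so \<open>D\<^sub>n\<close> is exponentially small there (\<open>cos_product_far\<close>).
\<close>

section \<open>Elementary inequalities for sine and cosine\<close>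

lemma mult_cos_le_sin:
  fixes x :: real
  assumes "0 \<le> x" "x \<le> pi"
  shows "x * cos x \<le> sin x"
proof -
  have "sin 0 - 0 * cos 0 \<le> sin x - x * cos x"
  proof (rule DERIV_nonneg_imp_nondecreasing[OF assms(1)])
    fix y assume y: "0 \<le> y" "y \<le> x"
    have "((\<lambda>x. sin x - x * cos x) has_real_derivative y * sin y) (at y)"
      by (auto intro!: derivative_eq_intros simp: algebra_simps)
    moreover have "0 \<le> y * sin y"
      using y assms by (intro mult_nonneg_nonneg sin_ge_zero) auto
    ultimately show "\<exists>d. ((\<lambda>x. sin x - x * cos x) has_real_derivative d) (at y) \<and> 0 \<le> d"
      by blast
  qed
  then show ?thesis by simp
qed

text \<open>Jordan's inequality: the quotient \<open>sin x / x\<close> decreases to its value at \<open>\<pi> / 2\<close>.\<close>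

lemma jordan_sin_lower_bound:
  fixes x :: real
  assumes "0 < x" "x \<le> pi / 2"
  shows "2 / pi * x \<le> sin x"
proof -
  have "sin (pi / 2) / (pi / 2) \<le> sin x / x"
  proof (rule DERIV_nonpos_imp_nonincreasing[OF assms(2)])
    fix y assume y: "x \<le> y" "y \<le> pi / 2"
    have "((\<lambda>x. sin x / x) has_real_derivative (y * cos y - sin y) / y\<^sup>2) (at y)"
      using y assms by (auto intro!: derivative_eq_intros simp: field_simps power2_eq_square)
    moreover have "(y * cos y - sin y) / y\<^sup>2 \<le> 0"
      using mult_cos_le_sin[of y] y assms by (intro divide_nonpos_nonneg) auto
    ultimately show "\<exists>d. ((\<lambda>x. sin x / x) has_real_derivative d) (at y) \<and> d \<le> 0"
      by blast
  qed
  then show ?thesis using assms by (simp add: field_simps)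
qed

text \<open>The function \<open>cos x exp (x\<^sup>2 / 2)\<close> starts at 1, and its derivative has the sign of
  \<open>x cos x - sin x\<close>.\<close>

lemma cos_le_gaussian:
  fixes x :: real
  assumes "0 \<le> x" "x \<le> pi / 2"
  shows "cos x \<le> exp (- (x\<^sup>2 / 2))"
proof -
  have "cos x * exp (x\<^sup>2 / 2) \<le> cos 0 * exp (0\<^sup>2 / 2)"
  proof (rule DERIV_nonpos_imp_nonincreasing[OF assms(1)])
    fix y assume y: "0 \<le> y" "y \<le> x"
    have "((\<lambda>x. cos x * exp (x\<^sup>2 / 2)) has_real_derivative
            (y * cos y - sin y) * exp (y\<^sup>2 / 2)) (at y)"
      by (auto intro!: derivative_eq_intros simp: algebra_simps)
    moreover have "(y * cos y - sin y) * exp (y\<^sup>2 / 2) \<le> 0"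
      using mult_cos_le_sin[of y] y assms by (intro mult_nonpos_nonneg) auto
    ultimately show "\<exists>d. ((\<lambda>x. cos x * exp (x\<^sup>2 / 2)) has_real_derivative d) (at y) \<and> d \<le> 0"
      by blast
  qed
  then show ?thesis by (simp add: exp_minus field_simps)
qed

text \<open>Here \<open>cos x \<ge> 1 - x\<^sup>2 / 2\<close>, by the half-angle formula, and \<open>ln (1 - z) \<ge> - z - 2 z\<^sup>2\<close>.\<close>

lemma cos_ge_gaussian_quartic:
  fixes x :: real
  assumes "\<bar>x\<bar> \<le> 1"
  shows "exp (- (x\<^sup>2 / 2) - x ^ 4 / 2) \<le> cos x"
proof -
  have x2: "x\<^sup>2 \<le> 1" using assms by (simp add: abs_square_le_1)
  have "(sin (x / 2))\<^sup>2 \<le> (x / 2)\<^sup>2"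
    using abs_sin_x_le_abs_x[of "x / 2"] by (simp only: abs_le_square_iff)
  then have c: "1 - x\<^sup>2 / 2 \<le> cos x"
    using cos_double_sin[of "x / 2"] by (simp add: power_divide)
  have "- (x\<^sup>2 / 2) - 2 * (x\<^sup>2 / 2)\<^sup>2 \<le> ln (1 - x\<^sup>2 / 2)"
    using x2 by (intro ln_one_minus_pos_lower_bound) auto
  then have "- (x\<^sup>2 / 2) - x ^ 4 / 2 \<le> ln (1 - x\<^sup>2 / 2)"
    by (simp add: power_divide flip: power_mult)
  then have "exp (- (x\<^sup>2 / 2) - x ^ 4 / 2) \<le> 1 - x\<^sup>2 / 2"
    using x2 by (subst (asm) ln_ge_iff) auto
  then show ?thesis using c by simp
qed

lemma abs_cos_le_exp_sin_square:
  fixes x :: real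
  shows "\<bar>cos x\<bar> \<le> exp (- ((sin x)\<^sup>2 / 2))"
proof -
  have "\<bar>cos x\<bar>\<^sup>2 \<le> (exp (- ((sin x)\<^sup>2 / 2)))\<^sup>2"
    using exp_ge_add_one_self[of "- (sin x)\<^sup>2"] by (simp add: cos_squared_eq flip: exp_double)
  then show ?thesis by (rule power2_le_imp_le) simp
qed

section \<open>The product of cosines\<close>

definition cos_product :: "nat \<Rightarrow> real \<Rightarrow> real" where
  "cos_product n \<theta> = (\<Prod>k = 1..n. \<bar>cos (real k * \<theta> / 2)\<bar>)"

lemma cos_product_nonneg: "0 \<le> cos_product n \<theta>"
  by (simp add: cos_product_def prod_nonneg)

lemma continuous_on_cos_product_powr:
  assumes "0 < p"
  shows "continuous_on A (\<lambda>\<theta>. cos_product n \<theta> powr p)"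
  unfolding cos_product_def using assms
  by (intro continuous_on_powr' continuous_intros ballI) (auto simp: prod_nonneg)

lemma cos_product_reflect: "cos_product n (2 * pi - \<theta>) = cos_product n \<theta>"
proof -
  have "\<bar>cos (real k * (2 * pi - \<theta>) / 2)\<bar> = \<bar>cos (real k * \<theta> / 2)\<bar>" for k
  proof -
    have "cos (real k * (2 * pi - \<theta>) / 2) = cos (real k * pi - real k * \<theta> / 2)"
      by (simp add: algebra_simps diff_divide_distrib)
    also have "\<dots> = (- 1) ^ k * cos (real k * \<theta> / 2)"
      by (simp add: cos_diff mult.commute)
    finally show ?thesis by (simp add: abs_mult power_abs)
  qed
  then show ?thesis by (simp add: cos_product_def)
qed

lemma cmod_1_plus_exp: "cmod (1 + exp (\<i> * of_real t)) = 2 * \<bar>cos (t / 2)\<bar>"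
proof -
  have "(cmod (1 + exp (\<i> * of_real t)))\<^sup>2 = (1 + cos t)\<^sup>2 + (sin t)\<^sup>2"
    by (simp add: cmod_power2 flip: cis_conv_exp)
  also have "\<dots> = 2 + 2 * cos t"
    by (simp add: power2_sum sin_squared_eq)
  also have "\<dots> = (2 * \<bar>cos (t / 2)\<bar>)\<^sup>2"
    using cos_double_cos[of "t / 2"] by (simp add: power_mult_distrib)
  finally show ?thesis by (rule power2_eq_imp_eq) auto
qed

lemma cmod_Q: "cmod (Q n \<theta>) = 2 ^ n * cos_product n \<theta>"
  using cmod_1_plus_exp[of "real k * \<theta>" for k]
  by (simp add: Q_def cos_product_def prod.distrib mult.assoc flip: prod_norm)

lemma sum_squares_real: "(\<Sum>k = 1..n. (real k)\<^sup>2) = real n * (real n + 1) * (2 * real n + 1) / 6"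
  by (induction n) (auto simp: field_simps power2_eq_square)

lemma cos_product_le_gaussian:
  assumes "0 \<le> \<theta>" "real n * \<theta> \<le> pi"
  shows "cos_product n \<theta> \<le> exp (- (real n * (real n + 1) * (2 * real n + 1) / 48 * \<theta>\<^sup>2))"
proof -
  have "cos_product n \<theta> \<le> (\<Prod>k = 1..n. exp (- ((real k * \<theta> / 2)\<^sup>2 / 2)))"
    unfolding cos_product_def
  proof (intro prod_mono conjI)
    fix k assume "k \<in> {1..n}"
    then have "real k * \<theta> \<le> pi"
      using assms mult_right_mono[of "real k" "real n" \<theta>] by auto
    then show "\<bar>cos (real k * \<theta> / 2)\<bar> \<le> exp (- ((real k * \<theta> / 2)\<^sup>2 / 2))"
      using assms cos_le_gaussian[of "real k * \<theta> / 2"] cos_ge_zero[of "real k * \<theta> / 2"]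
      by (simp add: order_trans[OF _ mult_nonneg_nonneg])
  qed auto
  also have "\<dots> = exp (\<Sum>k = 1..n. - (\<theta>\<^sup>2 / 8) * (real k)\<^sup>2)"
    by (simp add: exp_sum power_mult_distrib power_divide mult.commute)
  also have "(\<Sum>k = 1..n. - (\<theta>\<^sup>2 / 8) * (real k)\<^sup>2) =
               - (real n * (real n + 1) * (2 * real n + 1) / 48 * \<theta>\<^sup>2)"
    unfolding sum_distrib_left[symmetric] sum_squares_real by simp
  finally show ?thesis .
qed

lemma cos_product_ge_gaussian:
  assumes "0 \<le> \<theta>" "real n * \<theta> \<le> 2"
  shows "exp (- (real n * (real n + 1) * (2 * real n + 1) / 48 * \<theta>\<^sup>2) - real n ^ 5 * \<theta> ^ 4 / 32)
           \<le> cos_product n \<theta>"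
proof -
  have "(\<Sum>k = 1..n. real k ^ 4) \<le> of_nat (card {1..n}) * real n ^ 4"
    by (intro sum_bounded_above power_mono) auto
  then have k4: "(\<Sum>k = 1..n. real k ^ 4) \<le> real n ^ 5"
    by (simp add: power_Suc[symmetric] del: power_Suc)
  have "(\<Sum>k = 1..n. - (\<theta>\<^sup>2 / 8) * (real k)\<^sup>2 - \<theta> ^ 4 / 32 * real k ^ 4) =
          - (\<theta>\<^sup>2 / 8) * (\<Sum>k = 1..n. (real k)\<^sup>2) - \<theta> ^ 4 / 32 * (\<Sum>k = 1..n. real k ^ 4)"
    by (simp add: sum_subtractf sum_distrib_left)
  also have "\<dots> \<ge> - (\<theta>\<^sup>2 / 8) * (\<Sum>k = 1..n. (real k)\<^sup>2) - \<theta> ^ 4 / 32 * real n ^ 5"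
    using k4 by (intro diff_left_mono mult_left_mono) auto
  finally have "exp (- (real n * (real n + 1) * (2 * real n + 1) / 48 * \<theta>\<^sup>2) - real n ^ 5 * \<theta> ^ 4 / 32)
      \<le> exp (\<Sum>k = 1..n. - (\<theta>\<^sup>2 / 8) * (real k)\<^sup>2 - \<theta> ^ 4 / 32 * real k ^ 4)"
    unfolding sum_squares_real by (simp add: mult_ac)
  also have "\<dots> = (\<Prod>k = 1..n. exp (- ((real k * \<theta> / 2)\<^sup>2 / 2) - (real k * \<theta> / 2) ^ 4 / 2))"
    by (simp add: exp_sum power_mult_distrib power_divide mult.commute)
  also have "\<dots> \<le> cos_product n \<theta>"
    unfolding cos_product_def
  proof (intro prod_mono conjI)
    fix k assume "k \<in> {1..n}"
    then have "real k * \<theta> \<le> 2"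
      using assms mult_right_mono[of "real k" "real n" \<theta>] by auto
    then show "exp (- ((real k * \<theta> / 2)\<^sup>2 / 2) - (real k * \<theta> / 2) ^ 4 / 2) \<le> \<bar>cos (real k * \<theta> / 2)\<bar>"
      using assms by (intro order_trans[OF cos_ge_gaussian_quartic abs_ge_self]) auto
  qed auto
  finally show ?thesis .
qed

text \<open>The closed form of the Dirichlet kernel, obtained by telescoping.\<close>

lemma sum_cos_dirichlet:
  "2 * sin (\<theta> / 2) * (\<Sum>k = 1..n. cos (real k * \<theta>)) = sin ((real n + 1 / 2) * \<theta>) - sin (\<theta> / 2)"
proof (induction n)
  case (Suc n)
  have "2 * sin (\<theta> / 2) * cos (real (Suc n) * \<theta>) =
          sin (\<theta> / 2 + real (Suc n) * \<theta>) + sin (\<theta> / 2 - real (Suc n) * \<theta>)"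
    by (simp add: sin_add sin_diff)
  also have "\<theta> / 2 + real (Suc n) * \<theta> = (real (Suc n) + 1 / 2) * \<theta>"
    by (simp add: algebra_simps)
  also have "\<theta> / 2 - real (Suc n) * \<theta> = - ((real n + 1 / 2) * \<theta>)"
    by (simp add: algebra_simps)
  finally show ?case using Suc by (simp add: distrib_left)
qed simp

text \<open>By Jordan's inequality \<open>sin (\<theta> / 2) \<ge> 1 / n\<close>, so the Dirichlet kernel keeps the sum of the
  \<open>cos (k\<theta>)\<close> at most \<open>n / 2\<close>, half its trivial bound.\<close>

lemma cos_product_far:
  assumes "0 < n" "pi / real n \<le> \<theta>" "\<theta> \<le> pi"
  shows "cos_product n \<theta> \<le> exp (- (real n / 8))"
proof -
  have pos: "0 < \<theta>" using assms pi_gt_zero by (smt (verit) divide_pos_pos of_nat_0_less_iff)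
  have "1 / real n \<le> 2 / pi * (\<theta> / 2)"
    using assms by (simp add: field_simps)
  also have "\<dots> \<le> sin (\<theta> / 2)"
    using pos assms by (intro jordan_sin_lower_bound) auto
  finally have s: "1 / real n \<le> sin (\<theta> / 2)" .
  then have s0: "0 < sin (\<theta> / 2)"
    using assms by (smt (verit) divide_pos_pos of_nat_0_less_iff)
  have "2 * sin (\<theta> / 2) * (\<Sum>k = 1..n. cos (real k * \<theta>)) \<le> 1"
    unfolding sum_cos_dirichlet using s0 sin_le_one[of "(real n + 1 / 2) * \<theta>"] by linarith
  also have "1 \<le> 2 * sin (\<theta> / 2) * (real n / 2)"
    using s assms by (simp add: field_simps)
  finally have S: "(\<Sum>k = 1..n. cos (real k * \<theta>)) \<le> real n / 2"
    using s0 by (simp add: mult_le_cancel_left)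
  have sin2: "(sin (real k * \<theta> / 2))\<^sup>2 = (1 - cos (real k * \<theta>)) / 2" for k
    using cos_double_sin[of "real k * \<theta> / 2"] by simp
  have "cos_product n \<theta> \<le> (\<Prod>k = 1..n. exp (- ((sin (real k * \<theta> / 2))\<^sup>2 / 2)))"
    unfolding cos_product_def by (intro prod_mono conjI abs_cos_le_exp_sin_square) auto
  also have "\<dots> = exp (- ((\<Sum>k = 1..n. 1 - cos (real k * \<theta>)) / 4))"
    by (simp add: sin2 sum_divide_distrib sum_negf flip: exp_sum)
  also have "\<dots> \<le> exp (- (real n / 8))"
    using S by (simp add: sum_subtractf)
  finally show ?thesis .
qed

section \<open>Laplace's method for the integral of the product\<close>

text \<open>The scale at which the peak of \<open>cos_product n \<theta> powr p\<close> becomes the function \<open>exp (-x\<^sup>2)\<close>.\<close>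

definition peak_width :: "real \<Rightarrow> nat \<Rightarrow> real" where
  "peak_width p n = sqrt (24 / (p * real n ^ 3))"

lemma peak_width_pos: "0 < p \<Longrightarrow> 0 < n \<Longrightarrow> 0 < peak_width p n"
  by (simp add: peak_width_def)

lemma peak_width_square: "0 < p \<Longrightarrow> (peak_width p n)\<^sup>2 = 24 / (p * real n ^ 3)"
  by (simp add: peak_width_def)

lemma peak_width_mult_tendsto_0:
  assumes "0 < p"
  shows "(\<lambda>n. real n * (peak_width p n * x)) \<longlonglongrightarrow> 0"
proof -
  have "(\<lambda>n. sqrt (24 / p) * x * (real n * sqrt (1 / real n ^ 3))) \<longlonglongrightarrow> sqrt (24 / p) * x * 0"
    by (intro tendsto_mult tendsto_const) real_asymp
  moreover have "peak_width p n = sqrt (24 / p) * sqrt (1 / real n ^ 3)" for n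
    unfolding peak_width_def by (simp flip: real_sqrt_mult)
  ultimately show ?thesis by (simp add: mult_ac)
qed

lemma cos_product_rescaled_limit:
  assumes p: "0 < p" and x: "0 \<le> x"
  shows "(\<lambda>n. cos_product n (peak_width p n * x) powr p) \<longlonglongrightarrow> exp (- x\<^sup>2)"
proof -
  define a where "a = (\<lambda>n. real n * (real n + 1) * (2 * real n + 1) / 48 * (peak_width p n * x)\<^sup>2)"
  define b where "b = (\<lambda>n. real n ^ 5 * (peak_width p n * x) ^ 4 / 32)"
  have small: "\<forall>\<^sub>F n in sequentially. real n * (peak_width p n * x) < 2"
    using peak_width_mult_tendsto_0[OF p, of x] by (rule order_tendstoD) simp
  have nn: "0 \<le> peak_width p n * x" for n
    using p x by (simp add: peak_width_def)
  have a: "a \<longlonglongrightarrow> x\<^sup>2 / p"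
  proof -
    have "(\<lambda>n. x\<^sup>2 / p * (real n * (real n + 1) * (2 * real n + 1) / (2 * real n ^ 3)))
            \<longlonglongrightarrow> x\<^sup>2 / p * 1"
      by (intro tendsto_mult tendsto_const) real_asymp
    moreover have "k / 48 * (24 / (p * N) * X) = X / p * (k / (2 * N))" for k N X :: real
      by simp
    then have "a = (\<lambda>n. x\<^sup>2 / p * (real n * (real n + 1) * (2 * real n + 1) / (2 * real n ^ 3)))"
      unfolding a_def power_mult_distrib peak_width_square[OF p] by (intro ext)
    ultimately show ?thesis by simp
  qed
  have b: "b \<longlonglongrightarrow> 0"
  proof -
    have w4: "peak_width p n ^ 4 = (24 / (p * real n ^ 3))\<^sup>2" for n
      unfolding peak_width_square[OF p, symmetric] by simp
    have "(\<lambda>n. 18 * x ^ 4 / p\<^sup>2 * (real n ^ 5 / real n ^ 6)) \<longlonglongrightarrow> 18 * x ^ 4 / p\<^sup>2 * 0"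
      by (intro tendsto_mult tendsto_const) real_asymp
    moreover have "b = (\<lambda>n. 18 * x ^ 4 / p\<^sup>2 * (real n ^ 5 / real n ^ 6))"
      by (rule ext) (simp add: b_def power_mult_distrib w4 power_divide flip: power_mult)
    ultimately show ?thesis by simp
  qed
  have "(\<lambda>n. cos_product n (peak_width p n * x)) \<longlonglongrightarrow> exp (- (x\<^sup>2 / p))"
  proof (rule tendsto_sandwich)
    show "\<forall>\<^sub>F n in sequentially. exp (- a n - b n) \<le> cos_product n (peak_width p n * x)"
      using small unfolding a_def b_def
      by eventually_elim (intro cos_product_ge_gaussian nn, simp)
    show "\<forall>\<^sub>F n in sequentially. cos_product n (peak_width p n * x) \<le> exp (- a n)"
      using small unfolding a_def
      by eventually_elim (intro cos_product_le_gaussian nn, use pi_ge_two in simp)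
    show "(\<lambda>n. exp (- a n - b n)) \<longlonglongrightarrow> exp (- (x\<^sup>2 / p))"
      using tendsto_exp[OF tendsto_diff[OF tendsto_minus[OF a] b]] by simp
    show "(\<lambda>n. exp (- a n)) \<longlonglongrightarrow> exp (- (x\<^sup>2 / p))"
      by (intro tendsto_intros a)
  qed
  then have "(\<lambda>n. cos_product n (peak_width p n * x) powr p) \<longlonglongrightarrow> exp (- (x\<^sup>2 / p)) powr p"
    by (intro tendsto_powr tendsto_const) auto
  also have "exp (- (x\<^sup>2 / p)) powr p = exp (- x\<^sup>2)"
    using p by (simp add: powr_def)
  finally show ?thesis .
qed

lemma cos_product_rescaled_le:
  assumes p: "0 < p" and n: "0 < n" and x: "0 \<le> x" "peak_width p n * x \<le> pi / real n"
  shows "cos_product n (peak_width p n * x) powr p \<le> exp (- x\<^sup>2)"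
proof -
  have w: "0 < peak_width p n" using p n by (rule peak_width_pos)
  have "cos_product n (peak_width p n * x) \<le>
          exp (- (real n * (real n + 1) * (2 * real n + 1) / 48 * (peak_width p n * x)\<^sup>2))"
    using w x n by (intro cos_product_le_gaussian) (auto simp: field_simps)
  also have "\<dots> \<le> exp (- (2 * real n ^ 3 / 48 * (peak_width p n * x)\<^sup>2))"
  proof -
    have "2 * real n ^ 3 \<le> real n * (real n + 1) * (2 * real n + 1)"
      by (simp add: algebra_simps power3_eq_cube)
    then have "2 * real n ^ 3 / 48 * (peak_width p n * x)\<^sup>2
                 \<le> real n * (real n + 1) * (2 * real n + 1) / 48 * (peak_width p n * x)\<^sup>2"
      by (intro mult_right_mono divide_right_mono) auto
    then show ?thesis by simp
  qed
  also have "\<dots> = exp (- (x\<^sup>2 / p))"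
    using n p by (simp add: power_mult_distrib peak_width_square)
  finally have "cos_product n (peak_width p n * x) powr p \<le> exp (- (x\<^sup>2 / p)) powr p"
    using p by (intro powr_mono2 cos_product_nonneg) auto
  also have "\<dots> = exp (- x\<^sup>2)"
    using p by (simp add: powr_def)
  finally show ?thesis .
qed

lemma cos_product_peak_integral:
  assumes p: "0 < p"
  shows "(\<lambda>n. (LBINT \<theta>:{0..pi / real n}. cos_product n \<theta> powr p) / peak_width p n)
           \<longlonglongrightarrow> sqrt pi / 2"
proof -
  define s where "s = (\<lambda>n x. indicator {0..pi / real n} (peak_width p n * x) *\<^sub>R
                        (cos_product n (peak_width p n * x) powr p))"
  have gauss: "has_bochner_integral lborel (\<lambda>x. indicator {0..} x *\<^sub>R exp (- x\<^sup>2)) (sqrt pi / 2)"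
    by (rule gaussian_moment_0)
  \<comment> \<open>The index is shifted because \<open>peak_width p 0 = 0\<close>, by division by zero, so that \<open>s 0\<close>
      is the constant 1, which \<open>exp (-x\<^sup>2)\<close> does not dominate.\<close>
  have "(\<lambda>n. LBINT x. s (Suc n) x) \<longlonglongrightarrow> (LBINT x. indicator {0..} x *\<^sub>R exp (- x\<^sup>2))"
  proof (rule integral_dominated_convergence)
    show "integrable lborel (\<lambda>x::real. indicator {0..} x *\<^sub>R exp (- x\<^sup>2))"
      using gauss by (simp add: has_bochner_integral_iff)
    show "AE x in lborel. (\<lambda>n. s (Suc n) x) \<longlonglongrightarrow> indicator {0..} x *\<^sub>R exp (- x\<^sup>2)"
    proof (rule AE_I2)
      fix x :: real
      have "(\<lambda>n. s n x) \<longlonglongrightarrow> indicator {0..} x *\<^sub>R exp (- x\<^sup>2)"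
      proof (cases "0 \<le> x")
        case True
        have "\<forall>\<^sub>F n in sequentially. real n * (peak_width p n * x) < pi"
          using peak_width_mult_tendsto_0[OF p, of x] by (rule order_tendstoD) simp
        then have "\<forall>\<^sub>F n in sequentially. cos_product n (peak_width p n * x) powr p = s n x"
          using eventually_gt_at_top[of 0]
        proof eventually_elim
          case (elim n)
          then have "peak_width p n * x \<in> {0..pi / real n}"
            using True peak_width_pos[OF p, of n] by (simp add: field_simps)
          then show ?case by (simp add: s_def)
        qed
        with cos_product_rescaled_limit[OF p True] have "(\<lambda>n. s n x) \<longlonglongrightarrow> exp (- x\<^sup>2)"
          by (rule Lim_transform_eventually)
        then show ?thesis using True by simp
      next
        case False
        have "\<forall>\<^sub>F n in sequentially. s n x = 0"
          using eventually_gt_at_top[of 0]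
        proof eventually_elim
          case (elim n)
          then have "peak_width p n * x < 0"
            using False peak_width_pos[OF p, of n] by (simp add: mult_pos_neg)
          then show ?case by (simp add: s_def)
        qed
        then show ?thesis using False by (simp add: tendsto_eventually)
      qed
      then show "(\<lambda>n. s (Suc n) x) \<longlonglongrightarrow> indicator {0..} x *\<^sub>R exp (- x\<^sup>2)"
        by (rule LIMSEQ_Suc)
    qed
    show "AE x in lborel. norm (s (Suc n) x) \<le> indicator {0..} x *\<^sub>R exp (- x\<^sup>2)" for n
    proof (rule AE_I2)
      fix x :: real
      show "norm (s (Suc n) x) \<le> indicator {0..} x *\<^sub>R exp (- x\<^sup>2)"
      proof (cases "peak_width p (Suc n) * x \<in> {0..pi / real (Suc n)}")
        case True
        then have "0 \<le> x"
          using peak_width_pos[OF p, of "Suc n"] by (simp add: zero_le_mult_iff)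
        then show ?thesis
          using True cos_product_rescaled_le[OF p, of "Suc n" x] by (simp add: s_def)
      qed (simp add: s_def)
    qed
    show "s (Suc n) \<in> borel_measurable lborel" for n
      unfolding s_def cos_product_def by measurable
  qed auto
  then have lim: "(\<lambda>n. LBINT x. s n x) \<longlonglongrightarrow> sqrt pi / 2"
    unfolding has_bochner_integral_integral_eq[OF gauss] by (rule LIMSEQ_imp_Suc)
  have rescale: "(LBINT x. s n x) = (LBINT \<theta>:{0..pi / real n}. cos_product n \<theta> powr p) / peak_width p n"
    if "0 < n" for n
    using peak_width_pos[OF p that] unfolding set_lebesgue_integral_def s_def
    by (subst (2) lborel_integral_real_affine[where t = 0 and c = "peak_width p n"]) auto
  have "\<forall>\<^sub>F n in sequentially. (LBINT x. s n x) =
      (LBINT \<theta>:{0..pi / real n}. cos_product n \<theta> powr p) / peak_width p n"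
    using eventually_gt_at_top[of 0] by eventually_elim (rule rescale)
  with lim show ?thesis by (rule Lim_transform_eventually)
qed

lemma cos_product_tail_integral:
  assumes p: "0 < p"
  shows "(\<lambda>n. (LBINT \<theta>:{pi / real n..pi}. cos_product n \<theta> powr p) / peak_width p n) \<longlonglongrightarrow> 0"
proof (rule tendsto_sandwich[where f = "\<lambda>_. 0"])
  have w: "inverse (peak_width p n) = sqrt (p / 24) * sqrt (real n ^ 3)" for n
    unfolding peak_width_def real_sqrt_inverse[symmetric] real_sqrt_mult[symmetric]
    by (simp add: field_simps)
  have "(\<lambda>n. exp (- (p / 8 * real n)) * sqrt (real n ^ 3)) \<longlonglongrightarrow> 0"
    using p by real_asymp
  then have "(\<lambda>n. pi * sqrt (p / 24) * (exp (- (p / 8 * real n)) * sqrt (real n ^ 3)))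
               \<longlonglongrightarrow> pi * sqrt (p / 24) * 0"
    by (intro tendsto_mult tendsto_const)
  moreover have "exp (- (real n / 8)) powr p * pi / peak_width p n =
      pi * sqrt (p / 24) * (exp (- (p / 8 * real n)) * sqrt (real n ^ 3))" for n
    unfolding divide_inverse[of _ "peak_width p n"] w by (simp add: powr_def)
  ultimately show "(\<lambda>n. exp (- (real n / 8)) powr p * pi / peak_width p n) \<longlonglongrightarrow> 0"
    by simp
  show "\<forall>\<^sub>F n in sequentially.
          0 \<le> (LBINT \<theta>:{pi / real n..pi}. cos_product n \<theta> powr p) / peak_width p n"
    using p by (intro always_eventually allI divide_nonneg_nonneg)
      (auto simp: set_lebesgue_integral_def peak_width_def)
  show "\<forall>\<^sub>F n in sequentially. (LBINT \<theta>:{pi / real n..pi}. cos_product n \<theta> powr p) / peak_width p n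
          \<le> exp (- (real n / 8)) powr p * pi / peak_width p n"
    using eventually_gt_at_top[of 0]
  proof eventually_elim
    case (elim n)
    have le: "pi / real n \<le> pi" using elim by (simp add: field_simps)
    have "(LBINT \<theta>:{pi / real n..pi}. cos_product n \<theta> powr p)
            \<le> (LBINT \<theta>:{pi / real n..pi}. exp (- (real n / 8)) powr p)"
      using p elim
      by (intro set_integral_mono borel_integrable_atLeastAtMost' continuous_on_cos_product_powr
            continuous_on_const powr_mono2 cos_product_nonneg cos_product_far) auto
    also have "\<dots> = exp (- (real n / 8)) powr p * (pi - pi / real n)"
      using le by (simp add: set_lebesgue_integral_def)
    also have "\<dots> \<le> exp (- (real n / 8)) powr p * pi"
      by (intro mult_left_mono) auto
    finally show ?case
      using peak_width_pos[OF p elim] by (simp add: divide_right_mono)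
  qed
qed auto

lemma cos_product_integral_reflect:
  assumes p: "0 < p"
  shows "(LBINT \<theta>:{0..2 * pi}. cos_product n \<theta> powr p) =
           2 * (LBINT \<theta>:{0..pi}. cos_product n \<theta> powr p)"
proof -
  let ?f = "\<lambda>\<theta>. cos_product n \<theta> powr p"
  have "{0..2 * pi} = {0..pi} \<union> {pi..2 * pi}" by auto
  also have "(LBINT \<theta>:\<dots>. ?f \<theta>) = (LBINT \<theta>:{0..pi}. ?f \<theta>) + (LBINT \<theta>:{pi..2 * pi}. ?f \<theta>)"
    using AE_lborel_singleton[of pi] p
    by (intro set_integral_Un_AE borel_integrable_atLeastAtMost' continuous_on_cos_product_powr)
      (auto elim!: eventually_mono)
  also have "(LBINT \<theta>:{pi..2 * pi}. ?f \<theta>) = (LBINT \<theta>:{0..pi}. ?f \<theta>)"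
    unfolding set_lebesgue_integral_def
    by (subst lborel_integral_real_affine[where t = "2 * pi" and c = "- 1"])
      (auto simp: cos_product_reflect indicator_def intro!: Bochner_Integration.integral_cong)
  finally show ?thesis by simp
qed

lemma cos_product_half_integral:
  assumes p: "0 < p"
  shows "(\<lambda>n. (LBINT \<theta>:{0..pi}. cos_product n \<theta> powr p) / peak_width p n) \<longlonglongrightarrow> sqrt pi / 2"
proof -
  have split: "(LBINT \<theta>:{0..pi}. cos_product n \<theta> powr p) =
      (LBINT \<theta>:{0..pi / real n}. cos_product n \<theta> powr p) +
      (LBINT \<theta>:{pi / real n..pi}. cos_product n \<theta> powr p)" if n: "0 < n" for n
  proof -
    have "{0..pi} = {0..pi / real n} \<union> {pi / real n..pi}"
      using n by (intro ivl_disj_un_two_touch(4)[symmetric]) (auto simp: field_simps)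
    also have "(LBINT \<theta>:\<dots>. cos_product n \<theta> powr p) =
        (LBINT \<theta>:{0..pi / real n}. cos_product n \<theta> powr p) +
        (LBINT \<theta>:{pi / real n..pi}. cos_product n \<theta> powr p)"
      using AE_lborel_singleton[of "pi / real n"] p
      by (intro set_integral_Un_AE borel_integrable_atLeastAtMost' continuous_on_cos_product_powr)
        (auto elim!: eventually_mono)
    finally show ?thesis .
  qed
  have "(\<lambda>n. (LBINT \<theta>:{0..pi / real n}. cos_product n \<theta> powr p) / peak_width p n +
             (LBINT \<theta>:{pi / real n..pi}. cos_product n \<theta> powr p) / peak_width p n)
          \<longlonglongrightarrow> sqrt pi / 2 + 0"
    by (intro tendsto_add cos_product_peak_integral cos_product_tail_integral p)
  moreover have "\<forall>\<^sub>F n in sequentially.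
      (LBINT \<theta>:{0..pi / real n}. cos_product n \<theta> powr p) / peak_width p n +
      (LBINT \<theta>:{pi / real n..pi}. cos_product n \<theta> powr p) / peak_width p n =
      (LBINT \<theta>:{0..pi}. cos_product n \<theta> powr p) / peak_width p n"
    using eventually_gt_at_top[of 0] by eventually_elim (simp add: split add_divide_distrib)
  ultimately show ?thesis by (auto intro: Lim_transform_eventually)
qed

section \<open>The asymptotics of the norm\<close>

lemma circle_Lp_norm_Q:
  assumes p: "0 < p"
  shows "circle_Lp_norm p (Q n) =
           2 ^ n * ((LBINT \<theta>:{0..pi}. cos_product n \<theta> powr p) / pi) powr (1 / p)"
proof -
  define J where "J = (LBINT \<theta>:{0..pi}. cos_product n \<theta> powr p)"
  have "(LBINT \<theta>:{0..2 * pi}. cmod (Q n \<theta>) powr p) = (2 ^ n) powr p * (2 * J)"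
    by (simp add: cmod_Q powr_mult cos_product_nonneg cos_product_integral_reflect[OF p] J_def)
  then have "circle_Lp_norm p (Q n) = ((2 ^ n) powr p * (J / pi)) powr (1 / p)"
    by (simp add: circle_Lp_norm_def)
  also have "\<dots> = 2 ^ n * (J / pi) powr (1 / p)"
  proof -
    have "((2 ^ n) powr p) powr (1 / p) = (2 ^ n :: real)"
      using p by (simp add: powr_powr)
    then show ?thesis by (simp only: powr_mult)
  qed
  finally show ?thesis by (simp add: J_def)
qed

text \<open>The \<open>p\<close>-th power of the expected size of the norm, with the factor \<open>2\<^sup>n\<close> removed, is \<open>1 / \<pi>\<close>
  times the area \<open>\<surd>\<pi> / 2\<close> of the half Gaussian times the width of the peak.\<close>

lemma peak_mass_powr:
  assumes p: "0 < p" and n: "0 < n"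
  shows "(peak_width p n * (sqrt pi / 2) / pi) powr (1 / p) =
           (6 / (p * pi)) powr (1 / (2 * p)) * real n powr (- (3 / (2 * p)))"
proof -
  have "(peak_width p n * (sqrt pi / 2) / pi)\<^sup>2 = 6 / (p * pi) * real n powr (- 3)"
    using p n by (simp add: power_mult_distrib power_divide peak_width_square powr_minus)
      (simp add: field_simps power2_eq_square)
  then have "peak_width p n * (sqrt pi / 2) / pi = sqrt (6 / (p * pi) * real n powr (- 3))"
    using peak_width_pos[OF p n] by (intro real_sqrt_unique[symmetric]) auto
  also have "\<dots> = (6 / (p * pi) * real n powr (- 3)) powr (1 / 2)"
    using p by (intro powr_half_sqrt[symmetric]) auto
  also have "\<dots> = (6 / (p * pi)) powr (1 / 2) * real n powr (- (3 / 2))"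
    by (simp only: powr_mult powr_powr) simp
  finally show ?thesis
    by (simp only: powr_mult powr_powr) simp
qed

theorem theorem5:
  fixes p :: real
  assumes "1 \<le> p"
  shows "(\<lambda>n. circle_Lp_norm p (Q n))
           \<sim>[sequentially]
         (\<lambda>n. (6 / (p * pi)) powr (1 / (2 * p)) * 2 ^ n * real n powr (- (3 / (2 * p))))"
proof (rule asymp_equivI')
  have p: "0 < p" using assms by simp
  define J where "J = (\<lambda>n. LBINT \<theta>:{0..pi}. cos_product n \<theta> powr p)"
  have "(\<lambda>n. (J n / peak_width p n) / (sqrt pi / 2)) \<longlonglongrightarrow> (sqrt pi / 2) / (sqrt pi / 2)"
    unfolding J_def by (intro tendsto_divide tendsto_const cos_product_half_integral p) simp
  then have "(\<lambda>n. ((J n / peak_width p n) / (sqrt pi / 2)) powr (1 / p)) \<longlonglongrightarrow> 1 powr (1 / p)"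
    by (intro tendsto_powr tendsto_const) simp_all
  moreover have "\<forall>\<^sub>F n in sequentially. ((J n / peak_width p n) / (sqrt pi / 2)) powr (1 / p) =
      circle_Lp_norm p (Q n) /
      ((6 / (p * pi)) powr (1 / (2 * p)) * 2 ^ n * real n powr (- (3 / (2 * p))))"
    using eventually_gt_at_top[of 0]
  proof eventually_elim
    case (elim n)
    have "(J n / peak_width p n) / (sqrt pi / 2) = (J n / pi) / (peak_width p n * (sqrt pi / 2) / pi)"
      using peak_width_pos[OF p elim] by (simp add: field_simps)
    also have "\<dots> powr (1 / p) =
        (J n / pi) powr (1 / p) / (peak_width p n * (sqrt pi / 2) / pi) powr (1 / p)"
      by (rule powr_divide)
    also have "\<dots> = 2 ^ n * (J n / pi) powr (1 / p) /
        ((6 / (p * pi)) powr (1 / (2 * p)) * 2 ^ n * real n powr (- (3 / (2 * p))))"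
      unfolding peak_mass_powr[OF p elim] by simp
    finally show ?case by (simp add: circle_Lp_norm_Q[OF p] J_def)
  qed
  ultimately show "(\<lambda>n. circle_Lp_norm p (Q n) /
      ((6 / (p * pi)) powr (1 / (2 * p)) * 2 ^ n * real n powr (- (3 / (2 * p))))) \<longlonglongrightarrow> 1"
    by (auto intro: Lim_transform_eventually)
qed

end
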